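(* Let $R$ be a ring, let $I$ be a left ideal of $R$ and let $M=R/I$ be an l-finite Euclidean $R$-module. Then: (1) For all nonzero submodules $N$ and $L$ of $M$, $$l_R(M/N)+l_R(M/L)=l_R(M/(N+L))+l_R(M/(N\cap L)).$$ (2) For all nonzero elements $a,b\in M$, $|a|+|b|=|\gcd(a,b)|+|\mathrm{lcm}(a,b)|$.
   Context: Rings are unital and modules are left modules; $l_R$ denotes length. A poset is Artinian if every descending chain in it stabilizes. For $i\le j$ in a poset, $[i,j]:=\{k:i\le k\le j\}$ and $l([i,j]):=\sup\{k\in\mathbb{N}:\text{there is a chain } i=i_1<\cdots<i_k=j\}$. An $R$-module $M$ is a Euclidean module if there is a function $d_M:M\setminus\{0\}\to P$ to a poset $(P,\ge)$ such that $\mathrm{im}(d_M)$ is an Artinian poset and, for any nonzero $u,v\in M$, there are $q\in R$ and $r\in M$ with $u=qv+r$ and either $r=0$ or $d_M(r)<d_M(v)$. For a nonzero submodule $N\subseteq M$, $g(N):=\min\{d_M(x):0\neq x\in N\}$ (the least value; it is presupposed to exist). $M$ is l-finite if every interval in the poset $\mathrm{im}(d_M)$ has finite length, equivalently $l([g(M),d_M(m)])<\infty$ for all nonzero $m\in M$. In an l-finite Euclidean module every factor by a nonzero submodule has finite length. Every submodule of a Euclidean module is cyclic; $\gcd(a,b)$ denotes any generator of $Ra+Rb$ and $\mathrm{lcm}(a,b)$ any generator of $Ra\cap Rb$. For $m\in M$, $|m|:=l_R(M/Rm)$. *)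

theory Defs
  imports "HOL-Algebra.AbelCoset" "HOL-Algebra.Module" "HOL-Library.Extended_Nat"
begin

section \<open>Left modules over a not necessarily commutative ring\<close>

text \<open>The library's locale \<open>module\<close> requires the ring of scalars to be commutative.  The axioms
  below are the same, over an arbitrary unital ring.  The library's \<open>submodule\<close> needs no
  commutativity and is used as it is.\<close>

locale left_module = R?: ring R + M?: abelian_group M
  for R :: "('a, 'm) ring_scheme" (structure) and M :: "('a, 'b, 'c) module_scheme" (structure) +
  assumes smult_closed [simp, intro]:
      "\<lbrakk>a \<in> carrier R; x \<in> carrier M\<rbrakk> \<Longrightarrow> a \<odot>\<^bsub>M\<^esub> x \<in> carrier M"
    and smult_l_distr:
      "\<lbrakk>a \<in> carrier R; b \<in> carrier R; x \<in> carrier M\<rbrakk> \<Longrightarrow>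
        (a \<oplus> b) \<odot>\<^bsub>M\<^esub> x = a \<odot>\<^bsub>M\<^esub> x \<oplus>\<^bsub>M\<^esub> b \<odot>\<^bsub>M\<^esub> x"
    and smult_r_distr:
      "\<lbrakk>a \<in> carrier R; x \<in> carrier M; y \<in> carrier M\<rbrakk> \<Longrightarrow>
        a \<odot>\<^bsub>M\<^esub> (x \<oplus>\<^bsub>M\<^esub> y) = a \<odot>\<^bsub>M\<^esub> x \<oplus>\<^bsub>M\<^esub> a \<odot>\<^bsub>M\<^esub> y"
    and smult_assoc1:
      "\<lbrakk>a \<in> carrier R; b \<in> carrier R; x \<in> carrier M\<rbrakk> \<Longrightarrow>
        (a \<otimes> b) \<odot>\<^bsub>M\<^esub> x = a \<odot>\<^bsub>M\<^esub> (b \<odot>\<^bsub>M\<^esub> x)"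
    and smult_one [simp]: "x \<in> carrier M \<Longrightarrow> \<one> \<odot>\<^bsub>M\<^esub> x = x"

locale left_ideal = additive_subgroup I R for I and R (structure) +
  assumes l_closed: "\<lbrakk>x \<in> carrier R; a \<in> I\<rbrakk> \<Longrightarrow> x \<otimes> a \<in> I"

definition regular_module :: "('a, 'b) ring_scheme \<Rightarrow> ('a, 'a) module" where
  "regular_module R =
     \<lparr>carrier = carrier R, mult = mult R, one = one R, zero = zero R, add = add R, smult = mult R\<rparr>"

text \<open>A module record extends a ring record; its fields \<open>mult\<close> and \<open>one\<close> have no meaning for a
  module and are left undefined.\<close>

definition quot_module :: "('a, 'b, 'c) module_scheme \<Rightarrow> 'b set \<Rightarrow> ('a, 'b set) module" where
  "quot_module M N =
     \<lparr>carrier = a_rcosets\<^bsub>M\<^esub> N, mult = undefined, one = undefined, zero = N, add = set_add M,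
      smult = (\<lambda>r X. \<Union>x\<in>X. N +>\<^bsub>M\<^esub> (r \<odot>\<^bsub>M\<^esub> x))\<rparr>"

text \<open>The length of \<open>M\<close>: the supremum of all \<open>n\<close> for which there is a chain
  \<open>0 = C 0 \<subset> C 1 \<subset> \<dots> \<subset> C n = M\<close> of submodules.\<close>

definition module_length :: "('a, 'm) ring_scheme \<Rightarrow> ('a, 'b, 'c) module_scheme \<Rightarrow> enat" where
  "module_length R M =
     Sup {enat n | n. \<exists>C :: nat \<Rightarrow> 'b set.
            C 0 = {\<zero>\<^bsub>M\<^esub>} \<and> C n = carrier M \<and>
            (\<forall>i\<le>n. submodule (C i) R M) \<and> (\<forall>i<n. C i \<subset> C (Suc i))}"

definition cyclic_submodule ::
    "('a, 'm) ring_scheme \<Rightarrow> ('a, 'b, 'c) module_scheme \<Rightarrow> 'b \<Rightarrow> 'b set" where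
  "cyclic_submodule R M m = {r \<odot>\<^bsub>M\<^esub> m | r. r \<in> carrier R}"


section \<open>Euclidean modules\<close>

definition artinian_poset :: "'p::order set \<Rightarrow> bool" where
  "artinian_poset A \<longleftrightarrow>
     (\<forall>x :: nat \<Rightarrow> 'p. range x \<subseteq> A \<and> decseq x \<longrightarrow> (\<exists>n. \<forall>k\<ge>n. x k = x n))"

text \<open>The length of the interval \<open>[i, j]\<close> of the poset \<open>A\<close>; it counts the elements
  \<open>i = x 1 < \<dots> < x k = j\<close> of a chain, not its steps.\<close>

definition interval_length :: "'p::order set \<Rightarrow> 'p \<Rightarrow> 'p \<Rightarrow> enat" where
  "interval_length A i j =
     Sup {enat k | k. 1 \<le> k \<and> (\<exists>x :: nat \<Rightarrow> 'p.
            x 1 = i \<and> x k = j \<and> (\<forall>m\<in>{1..k}. x m \<in> A) \<and> (\<forall>m\<in>{1..<k}. x m < x (Suc m)))}"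

text \<open>Only the values of \<open>d\<close> on the nonzero elements of \<open>M\<close> matter.\<close>

definition degree_image :: "('a, 'b, 'c) module_scheme \<Rightarrow> ('b \<Rightarrow> 'p) \<Rightarrow> 'p set" where
  "degree_image M d = d ` (carrier M - {\<zero>\<^bsub>M\<^esub>})"

locale euclidean_module = left_module R M
  for R :: "('a, 'm) ring_scheme" (structure) and M :: "('a, 'b, 'c) module_scheme" (structure)
    and d :: "'b \<Rightarrow> 'p::order" +
  assumes artinian: "artinian_poset (degree_image M d)"
    and division:
      "\<lbrakk>u \<in> carrier M - {\<zero>\<^bsub>M\<^esub>}; v \<in> carrier M - {\<zero>\<^bsub>M\<^esub>}\<rbrakk> \<Longrightarrow>
        \<exists>q\<in>carrier R. \<exists>r\<in>carrier M. u = q \<odot>\<^bsub>M\<^esub> v \<oplus>\<^bsub>M\<^esub> r \<and> (r = \<zero>\<^bsub>M\<^esub> \<or> d r < d v)"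

locale l_finite_euclidean_module = euclidean_module +
  assumes interval_finite:
    "\<lbrakk>i \<in> degree_image M d; j \<in> degree_image M d; i \<le> j\<rbrakk> \<Longrightarrow>
      interval_length (degree_image M d) i j < \<infinity>"

definition is_gcd ::
    "('a, 'm) ring_scheme \<Rightarrow> ('a, 'b, 'c) module_scheme \<Rightarrow> 'b \<Rightarrow> 'b \<Rightarrow> 'b \<Rightarrow> bool" where
  "is_gcd R M a b g \<longleftrightarrow> g \<in> carrier M \<and>
     cyclic_submodule R M g = cyclic_submodule R M a <+>\<^bsub>M\<^esub> cyclic_submodule R M b"

definition is_lcm ::
    "('a, 'm) ring_scheme \<Rightarrow> ('a, 'b, 'c) module_scheme \<Rightarrow> 'b \<Rightarrow> 'b \<Rightarrow> 'b \<Rightarrow> bool" where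
  "is_lcm R M a b l \<longleftrightarrow> l \<in> carrier M \<and>
     cyclic_submodule R M l = cyclic_submodule R M a \<inter> cyclic_submodule R M b"

definition elem_length ::
    "('a, 'm) ring_scheme \<Rightarrow> ('a, 'b, 'c) module_scheme \<Rightarrow> 'b \<Rightarrow> enat" where
  "elem_length R M m = module_length R (quot_module M (cyclic_submodule R M m))"


section \<open>Basic facts\<close>

lemma regular_module_simps [simp]:
  "carrier (regular_module R) = carrier R" "add (regular_module R) = add R"
  "zero (regular_module R) = zero R" "smult (regular_module R) = mult R"
  by (simp_all add: regular_module_def)

lemma quot_module_simps:
  "carrier (quot_module M N) = a_rcosets\<^bsub>M\<^esub> N" "add (quot_module M N) = set_add M"
  "zero (quot_module M N) = N"
  "smult (quot_module M N) = (\<lambda>r X. \<Union>x\<in>X. N +>\<^bsub>M\<^esub> (r \<odot>\<^bsub>M\<^esub> x))"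
  by (simp_all add: quot_module_def)

lemma (in ring) left_module_regular_module: "left_module R (regular_module R)"
proof -
  have "abelian_group (regular_module R)"
    by (rule abelian_groupI) (auto intro: add.m_comm add.m_assoc a_closed l_neg)
  then show ?thesis
    by (intro left_module.intro left_module_axioms.intro)
       (auto simp: ring_axioms l_distr r_distr m_assoc)
qed

lemma left_ideal_iff_submodule: "left_ideal I R \<longleftrightarrow> submodule I R (regular_module R)"
proof -
  have "m_inv (add_monoid (regular_module R)) = m_inv (add_monoid R)"
    by (simp add: m_inv_def fun_eq_iff)
  then have "subgroup I (add_monoid (regular_module R)) \<longleftrightarrow> subgroup I (add_monoid R)"
    by (simp add: subgroup_def)
  then show ?thesis
    by (simp add: left_ideal_def left_ideal_axioms_def additive_subgroup_def submodule_def
        submodule_axioms_def)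
qed

context left_module
begin

lemma smult_r_null: "a \<in> carrier R \<Longrightarrow> a \<odot>\<^bsub>M\<^esub> \<zero>\<^bsub>M\<^esub> = \<zero>\<^bsub>M\<^esub>"
  by (metis M.add.r_cancel_one' M.zero_closed M.r_zero smult_closed smult_r_distr)

lemma smult_l_null: "x \<in> carrier M \<Longrightarrow> \<zero> \<odot>\<^bsub>M\<^esub> x = \<zero>\<^bsub>M\<^esub>"
  by (metis M.add.r_cancel_one' R.zero_closed R.r_zero smult_closed smult_l_distr)

context
  fixes N assumes N: "submodule N R M"
begin

interpretation N: abelian_subgroup N M
  by (rule abelian_subgroupI3)
     (use N in \<open>auto simp: additive_subgroup_def submodule_def M.abelian_group_axioms\<close>)

lemma quot_smult:
  assumes r: "r \<in> carrier R" and x: "x \<in> carrier M"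
  shows "r \<odot>\<^bsub>quot_module M N\<^esub> (N +>\<^bsub>M\<^esub> x) = N +>\<^bsub>M\<^esub> (r \<odot>\<^bsub>M\<^esub> x)"
proof -
  have eq: "N +>\<^bsub>M\<^esub> (r \<odot>\<^bsub>M\<^esub> y) = N +>\<^bsub>M\<^esub> (r \<odot>\<^bsub>M\<^esub> x)" if y: "y \<in> N +>\<^bsub>M\<^esub> x" for y
  proof -
    obtain n where n: "n \<in> N" "y = n \<oplus>\<^bsub>M\<^esub> x"
      using y by (auto simp: a_r_coset_def')
    have nM: "n \<in> carrier M" using n N.a_Hcarr by auto
    have "r \<odot>\<^bsub>M\<^esub> n \<in> N"
      using N n r by (auto simp: submodule_def submodule_axioms_def)
    moreover have "r \<odot>\<^bsub>M\<^esub> y = r \<odot>\<^bsub>M\<^esub> n \<oplus>\<^bsub>M\<^esub> r \<odot>\<^bsub>M\<^esub> x"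
      using n nM r x by (simp add: smult_r_distr)
    ultimately have "r \<odot>\<^bsub>M\<^esub> y \<in> N +>\<^bsub>M\<^esub> (r \<odot>\<^bsub>M\<^esub> x)"
      by (auto simp: a_r_coset_def')
    then show ?thesis
      using r x N.a_repr_independence' by auto
  qed
  have "x \<in> N +>\<^bsub>M\<^esub> x"
    using x N.a_rcos_self by auto
  then have "(\<Union>y\<in>N +>\<^bsub>M\<^esub> x. N +>\<^bsub>M\<^esub> (r \<odot>\<^bsub>M\<^esub> y)) = N +>\<^bsub>M\<^esub> (r \<odot>\<^bsub>M\<^esub> x)"
    by (intro SUP_eq_const) (use eq in blast)+
  then show ?thesis
    by (simp add: quot_module_simps)
qed

lemma left_module_quot_module: "left_module R (quot_module M N)"
proof -
  have rep: "\<exists>x\<in>carrier M. X = N +>\<^bsub>M\<^esub> x" if "X \<in> carrier (quot_module M N)" for X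
    using that by (auto simp: quot_module_simps A_RCOSETS_def')
  have inc: "N +>\<^bsub>M\<^esub> x \<in> carrier (quot_module M N)" if "x \<in> carrier M" for x
    using that by (auto simp: quot_module_simps A_RCOSETS_def')
  have add: "(N +>\<^bsub>M\<^esub> x) \<oplus>\<^bsub>quot_module M N\<^esub> (N +>\<^bsub>M\<^esub> y) = N +>\<^bsub>M\<^esub> (x \<oplus>\<^bsub>M\<^esub> y)"
    if "x \<in> carrier M" "y \<in> carrier M" for x y
    using that by (simp add: quot_module_simps N.a_rcos_sum)
  have zero: "N +>\<^bsub>M\<^esub> \<zero>\<^bsub>M\<^esub> = \<zero>\<^bsub>quot_module M N\<^esub>"
    using N.a_subset by (simp add: quot_module_simps M.a_coset_add_zero)
  have ab: "abelian_group (quot_module M N)"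
  proof (rule abelian_groupI)
    fix X Y assume "X \<in> carrier (quot_module M N)" "Y \<in> carrier (quot_module M N)"
    then show "X \<oplus>\<^bsub>quot_module M N\<^esub> Y \<in> carrier (quot_module M N)"
      using rep[of X] rep[of Y] by (auto simp: add intro!: inc)
  next
    show "\<zero>\<^bsub>quot_module M N\<^esub> \<in> carrier (quot_module M N)"
      using inc[of "\<zero>\<^bsub>M\<^esub>"] zero by simp
  next
    fix X Y Z
    assume "X \<in> carrier (quot_module M N)" "Y \<in> carrier (quot_module M N)"
      "Z \<in> carrier (quot_module M N)"
    then show "(X \<oplus>\<^bsub>quot_module M N\<^esub> Y) \<oplus>\<^bsub>quot_module M N\<^esub> Z =
        X \<oplus>\<^bsub>quot_module M N\<^esub> (Y \<oplus>\<^bsub>quot_module M N\<^esub> Z)"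
      using rep[of X] rep[of Y] rep[of Z] by (auto simp: add M.a_assoc)
  next
    fix X Y assume "X \<in> carrier (quot_module M N)" "Y \<in> carrier (quot_module M N)"
    then show "X \<oplus>\<^bsub>quot_module M N\<^esub> Y = Y \<oplus>\<^bsub>quot_module M N\<^esub> X"
      using rep[of X] rep[of Y] by (auto simp: add M.a_comm)
  next
    fix X assume "X \<in> carrier (quot_module M N)"
    then obtain x where x: "x \<in> carrier M" "X = N +>\<^bsub>M\<^esub> x"
      using rep by blast
    show "\<zero>\<^bsub>quot_module M N\<^esub> \<oplus>\<^bsub>quot_module M N\<^esub> X = X"
      using x by (subst zero[symmetric]) (simp add: add)
    have "(N +>\<^bsub>M\<^esub> (\<ominus>\<^bsub>M\<^esub> x)) \<oplus>\<^bsub>quot_module M N\<^esub> X = \<zero>\<^bsub>quot_module M N\<^esub>"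
      using x zero by (simp add: add M.l_neg)
    then show "\<exists>Y\<in>carrier (quot_module M N). Y \<oplus>\<^bsub>quot_module M N\<^esub> X = \<zero>\<^bsub>quot_module M N\<^esub>"
      using x inc[of "\<ominus>\<^bsub>M\<^esub> x"] by auto
  qed
  show ?thesis
  proof (intro left_module.intro left_module_axioms.intro ab R.ring_axioms)
    fix a X assume "a \<in> carrier R" "X \<in> carrier (quot_module M N)"
    then show "a \<odot>\<^bsub>quot_module M N\<^esub> X \<in> carrier (quot_module M N)"
      using rep[of X] by (auto simp: quot_smult intro!: inc)
  next
    fix a b X assume "a \<in> carrier R" "b \<in> carrier R" "X \<in> carrier (quot_module M N)"
    then show "(a \<oplus> b) \<odot>\<^bsub>quot_module M N\<^esub> X =
        a \<odot>\<^bsub>quot_module M N\<^esub> X \<oplus>\<^bsub>quot_module M N\<^esub> b \<odot>\<^bsub>quot_module M N\<^esub> X"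
      using rep[of X] by (auto simp: quot_smult add smult_l_distr)
  next
    fix a X Y
    assume "a \<in> carrier R" "X \<in> carrier (quot_module M N)" "Y \<in> carrier (quot_module M N)"
    then show "a \<odot>\<^bsub>quot_module M N\<^esub> (X \<oplus>\<^bsub>quot_module M N\<^esub> Y) =
        a \<odot>\<^bsub>quot_module M N\<^esub> X \<oplus>\<^bsub>quot_module M N\<^esub> a \<odot>\<^bsub>quot_module M N\<^esub> Y"
      using rep[of X] rep[of Y] by (auto simp: quot_smult add smult_r_distr)
  next
    fix a b X assume "a \<in> carrier R" "b \<in> carrier R" "X \<in> carrier (quot_module M N)"
    then show "(a \<otimes> b) \<odot>\<^bsub>quot_module M N\<^esub> X =
        a \<odot>\<^bsub>quot_module M N\<^esub> (b \<odot>\<^bsub>quot_module M N\<^esub> X)"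
      using rep[of X] by (auto simp: quot_smult smult_assoc1)
  next
    fix X assume "X \<in> carrier (quot_module M N)"
    then show "\<one> \<odot>\<^bsub>quot_module M N\<^esub> X = X"
      using rep[of X] by (auto simp: quot_smult)
  qed
qed

end

end

text \<open>Every submodule of a Euclidean module is cyclic, so greatest common divisors and least common
  multiples exist.\<close>

lemma (in euclidean_module) submodule_cyclic:
  assumes N: "submodule N R M"
  shows "\<exists>g\<in>N. N = cyclic_submodule R M g"
proof (cases "N = {\<zero>\<^bsub>M\<^esub>}")
  case True
  moreover have "cyclic_submodule R M \<zero>\<^bsub>M\<^esub> = {\<zero>\<^bsub>M\<^esub>}"
    unfolding cyclic_submodule_def
  proof (intro equalityI subsetI)
    show "x \<in> {r \<odot>\<^bsub>M\<^esub> \<zero>\<^bsub>M\<^esub> | r. r \<in> carrier R}" if "x \<in> {\<zero>\<^bsub>M\<^esub>}" for x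
      using that smult_r_null[OF R.zero_closed] R.zero_closed by force
  qed (use smult_r_null in auto)
  ultimately show ?thesis
    by simp
next
  case False
  have sg: "subgroup N (add_monoid M)"
    and smult: "\<And>r x. r \<in> carrier R \<Longrightarrow> x \<in> N \<Longrightarrow> r \<odot>\<^bsub>M\<^esub> x \<in> N"
    using N by (simp_all add: submodule_def submodule_axioms_def)
  have sub: "N \<subseteq> carrier M" and zero: "\<zero>\<^bsub>M\<^esub> \<in> N"
    and add: "\<And>x y. x \<in> N \<Longrightarrow> y \<in> N \<Longrightarrow> x \<oplus>\<^bsub>M\<^esub> y \<in> N"
    using subgroup.subset[OF sg] subgroup.one_closed[OF sg] subgroup.m_closed[OF sg] by simp_all
  have neg: "\<And>x. x \<in> N \<Longrightarrow> \<ominus>\<^bsub>M\<^esub> x \<in> N"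
    using subgroup.m_inv_closed[OF sg] by (simp add: a_inv_def)
  have "\<exists>g\<in>N - {\<zero>\<^bsub>M\<^esub>}. \<forall>r\<in>N - {\<zero>\<^bsub>M\<^esub>}. \<not> d r < d g"
  proof (rule ccontr)
    assume "\<not> ?thesis"
    then have step: "\<And>g. g \<in> N - {\<zero>\<^bsub>M\<^esub>} \<Longrightarrow> \<exists>r. r \<in> N - {\<zero>\<^bsub>M\<^esub>} \<and> d r < d g"
      by blast
    obtain g0 where "g0 \<in> N - {\<zero>\<^bsub>M\<^esub>}"
      using False zero by blast
    then have "\<exists>f. \<forall>n. f n \<in> N - {\<zero>\<^bsub>M\<^esub>} \<and> d (f (Suc n)) < d (f n)"
      using step by (intro dependent_nat_choice) auto
    then obtain f where f: "\<And>n. f n \<in> N - {\<zero>\<^bsub>M\<^esub>}" "\<And>n :: nat. d (f (Suc n)) < d (f n)"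
      by blast
    have "range (\<lambda>n. d (f n)) \<subseteq> degree_image M d"
      using f(1) sub by (auto simp: degree_image_def)
    moreover have "decseq (\<lambda>n. d (f n))"
      by (rule decseq_SucI) (rule less_imp_le, rule f(2))
    ultimately obtain n where n: "\<forall>k\<ge>n. d (f k) = d (f n)"
      using artinian unfolding artinian_poset_def by blast
    have "d (f (Suc n)) = d (f n)"
      by (rule n[rule_format]) simp
    with f(2)[of n] show False by simp
  qed
  then obtain g where g: "g \<in> N" "g \<noteq> \<zero>\<^bsub>M\<^esub>" and min: "\<And>r. r \<in> N \<Longrightarrow> r \<noteq> \<zero>\<^bsub>M\<^esub> \<Longrightarrow> \<not> d r < d g"
    by blast
  have "u \<in> cyclic_submodule R M g" if u: "u \<in> N" for u
  proof (cases "u = \<zero>\<^bsub>M\<^esub>")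
    case True
    then show ?thesis
      using g sub smult_l_null[of g] R.zero_closed unfolding cyclic_submodule_def by force
  next
    case False
    then obtain q r where qr: "q \<in> carrier R" "r \<in> carrier M" "u = q \<odot>\<^bsub>M\<^esub> g \<oplus>\<^bsub>M\<^esub> r"
        "r = \<zero>\<^bsub>M\<^esub> \<or> d r < d g"
      using division[of u g] u g sub by (auto simp: subset_iff)
    have "r = \<ominus>\<^bsub>M\<^esub> (q \<odot>\<^bsub>M\<^esub> g) \<oplus>\<^bsub>M\<^esub> u"
      using qr g sub by (simp add: M.r_neg1 subset_iff)
    then have "r \<in> N"
      using add neg smult qr(1) g(1) u by simp
    then have "r = \<zero>\<^bsub>M\<^esub>"
      using min qr(4) by blast
    then have "u = q \<odot>\<^bsub>M\<^esub> g"
      using qr g sub by (simp add: subset_iff)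
    then show ?thesis
      using qr(1) by (auto simp: cyclic_submodule_def)
  qed
  moreover have "cyclic_submodule R M g \<subseteq> N"
    using smult g by (auto simp: cyclic_submodule_def)
  ultimately show ?thesis
    using g by blast
qed

text \<open>If a poset, such as \<open>degree_image M d\<close>, has a least element \<open>g\<close>, finiteness of all its
  intervals can be tested on those starting at \<open>g\<close>.\<close>

lemma intervals_finite_iff_least:
  fixes A :: "'p::order set"
  assumes gA: "g \<in> A" and least: "\<And>j. j \<in> A \<Longrightarrow> g \<le> j"
  shows "(\<forall>i\<in>A. \<forall>j\<in>A. i \<le> j \<longrightarrow> interval_length A i j < \<infinity>) \<longleftrightarrow>
         (\<forall>j\<in>A. interval_length A g j < \<infinity>)"
proof
  assume R: "\<forall>j\<in>A. interval_length A g j < \<infinity>"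
  have "interval_length A i j \<le> interval_length A g j" if i: "i \<in> A" for i j
    unfolding interval_length_def
  proof (rule Sup_mono, clarify)
    fix k x assume k: "1 \<le> k" and x: "\<forall>m\<in>{1..k}. x m \<in> A" "\<forall>m\<in>{1..<k}. x m < x (Suc m)"
      and "i = x 1" "j = x k"
    show "\<exists>b\<in>{enat n | n. 1 \<le> n \<and> (\<exists>y. y 1 = g \<and> y n = x k \<and> (\<forall>m\<in>{1..n}. y m \<in> A) \<and>
            (\<forall>m\<in>{1..<n}. y m < y (Suc m)))}. enat k \<le> b"
    proof (cases "x 1 = g")
      case True
      with k x show ?thesis by blast
    next
      case False
      then have lt: "g < x 1"
        using least x(1) k by (simp add: order.strict_iff_order)
      define y where "y m = (if m = 1 then g else x (m - 1))" for m
      have "y m < y (Suc m)" if "m \<in> {1..<Suc k}" for m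
      proof (cases "m = 1")
        case False
        with that have "m - 1 \<in> {1..<k}" "Suc (m - 1) = m"
          by auto
        with x(2) have "x (m - 1) < x m"
          by metis
        with False that show ?thesis
          by (simp add: y_def)
      qed (use lt in \<open>simp add: y_def\<close>)
      moreover have "\<forall>m\<in>{1..Suc k}. y m \<in> A"
      proof
        fix m assume "m \<in> {1..Suc k}"
        then have "m = 1 \<or> m - 1 \<in> {1..k}"
          by auto
        with x(1) gA show "y m \<in> A"
          by (auto simp only: y_def split: if_splits)
      qed
      moreover have "y 1 = g" "y (Suc k) = x k"
        using k by (auto simp: y_def)
      ultimately have "enat (Suc k) \<in> {enat n | n. 1 \<le> n \<and> (\<exists>y. y 1 = g \<and> y n = x k \<and>
          (\<forall>m\<in>{1..n}. y m \<in> A) \<and> (\<forall>m\<in>{1..<n}. y m < y (Suc m)))}"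
        by (intro CollectI exI[of _ "Suc k"] exI[of _ y] conjI ballI) auto
      then show ?thesis
        by (rule rev_bexI) simp
    qed
  qed
  with R show "\<forall>i\<in>A. \<forall>j\<in>A. i \<le> j \<longrightarrow> interval_length A i j < \<infinity>"
    by (meson order.strict_trans1)
qed (use assms in blast)

end

theory Submission
  imports Defs
begin

text \<open>The length of \<open>M/N\<close> is the length of the interval \<open>[N, M]\<close> in the modular lattice of
  submodules.  Interval lengths are additive, with values in \<open>enat\<close>: intersecting a chain from \<open>A\<close>
  to \<open>C\<close> with an intermediate \<open>B\<close> and adding \<open>B\<close> to it yields chains in \<open>[A, B]\<close> and \<open>[B, C]\<close>, and
  by modularity each step of the chain stays strict in at least one of them.  Splitting \<open>[N, M]\<close>
  at \<open>N + L\<close> and \<open>[N \<inter> L, M]\<close> at \<open>L\<close>, the identity reduces to the isomorphism of the intervals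
  \<open>[N, N + L]\<close> and \<open>[N \<inter> L, L]\<close>.\<close>

section \<open>Lengths of chains between two elements of a poset\<close>

text \<open>Steps are counted here, not elements as in \<open>interval_length\<close>, so that
  lengths add when chains are concatenated. With \<open>S\<close> the set of submodules, ordered by
  inclusion, this is the supremum in \<open>module_length\<close>. If no chain joins
  \<open>a\<close> to \<open>b\<close>, the value is 0, the supremum of the empty set in
  \<open>enat\<close>.\<close>

definition chain_length :: "'p::order set \<Rightarrow> 'p \<Rightarrow> 'p \<Rightarrow> enat" where
  "chain_length S a b =
     Sup {enat n | n. \<exists>C :: nat \<Rightarrow> 'p. C 0 = a \<and> C n = b \<and> (\<forall>i\<le>n. C i \<in> S) \<and> (\<forall>i<n. C i < C (Suc i))}"

lemma chain_mono:
  fixes C :: "nat \<Rightarrow> 'p::order"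
  assumes "\<And>i. i < n \<Longrightarrow> C i \<le> C (Suc i)" and "i \<le> j" "j \<le> n"
  shows "C i \<le> C j"
  using assms(2,3)
proof (induction j rule: dec_induct)
  case (step k)
  then have "C i \<le> C k" "C k \<le> C (Suc k)"
    using assms(1)[of k] by auto
  then show ?case by order
qed simp

lemma enat_le_chain_length:
  assumes "C 0 = a" "C n = b" "\<And>i. i \<le> n \<Longrightarrow> C i \<in> S" "\<And>i. i < n \<Longrightarrow> C i < C (Suc i)"
  shows "enat n \<le> chain_length S a b"
  unfolding chain_length_def by (rule Sup_upper) (use assms in blast)

lemma chain_length_least:
  assumes "\<And>n C. \<lbrakk>C 0 = a; C n = b; \<And>i. i \<le> n \<Longrightarrow> C i \<in> S; \<And>i. i < n \<Longrightarrow> C i < C (Suc i)\<rbrakk>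
      \<Longrightarrow> enat n \<le> z"
  shows "chain_length S a b \<le> z"
  unfolding chain_length_def by (rule Sup_least) (use assms in blast)

text \<open>An infinite supremum is not attained, so the chain obtained has at least, not exactly,
  \<open>m\<close> steps. For \<open>m = 0\<close>, where the bound carries no information, a chain
  still has to be found: by \<open>a \<le> b\<close> it is constant or a single step.\<close>

lemma chain_of_enat_le_chain_length:
  assumes "a \<in> S" "b \<in> S" "a \<le> b" "enat m \<le> chain_length S a b"
  obtains n C where "m \<le> n" "C 0 = a" "C n = b" "\<And>i. i \<le> n \<Longrightarrow> C i \<in> S"
    "\<And>i. i < n \<Longrightarrow> C i < C (Suc i)"
proof (cases "m = 0")
  case True
  show thesis
  proof (cases "a = b")
    case True
    show thesis
      by (rule that[of 0 "\<lambda>_. a"]) (use \<open>m = 0\<close> True assms in auto)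
  next
    case False
    show thesis
      by (rule that[of 1 "\<lambda>i. if i = 0 then a else b"]) (use \<open>m = 0\<close> False assms in auto)
  qed
next
  case False
  have "\<exists>n C. m \<le> n \<and> C 0 = a \<and> C n = b \<and> (\<forall>i\<le>n. C i \<in> S) \<and> (\<forall>i<n. C i < C (Suc i))"
  proof (rule ccontr)
    assume no: "\<not> ?thesis"
    \<comment> \<open>If every chain has fewer than \<open>m\<close> steps, then so does the
      supremum; \<open>m - 1\<close> is a proper predecessor because \<open>m\<close> is
      nonzero.\<close>
    have "chain_length S a b \<le> enat (m - 1)"
    proof (rule chain_length_least)
      fix n C
      assume "C 0 = a" "C n = b" "\<And>i. i \<le> n \<Longrightarrow> C i \<in> S" "\<And>i. i < n \<Longrightarrow> C i < C (Suc i)"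
      then have "\<not> m \<le> n"
        using no by blast
      then show "enat n \<le> enat (m - 1)" by simp
    qed
    with assms(4) have "enat m \<le> enat (m - 1)" by (rule order_trans)
    with False show False by simp
  qed
  then show thesis
    using that by blast
qed

text \<open>Reduces a bound on a sum of two suprema to finite lower bounds of each, which is what
  concatenating chains supplies. An infinite summand has arbitrarily large natural lower bounds, so
  it can only occur when \<open>z\<close> is infinite.\<close>

lemma enat_add_le:
  fixes x y z :: enat
  assumes "\<And>m n. enat m \<le> x \<Longrightarrow> enat n \<le> y \<Longrightarrow> enat (m + n) \<le> z"
  shows "x + y \<le> z"
proof (cases z)
  case (enat k)
  have "x \<noteq> \<infinity>"
    using assms[of "Suc k" 0] enat by (cases x) (simp_all flip: zero_enat_def)
  moreover have "y \<noteq> \<infinity>"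
    using assms[of 0 "Suc k"] enat by (cases y) (simp_all flip: zero_enat_def)
  ultimately show ?thesis
    using assms by auto
qed simp

lemma chain_length_superadditive:
  assumes "a \<in> S" "b \<in> S" "c \<in> S" "a \<le> b" "b \<le> c"
  shows "chain_length S a b + chain_length S b c \<le> chain_length S a c"
proof (rule enat_add_le)
  fix m n assume m: "enat m \<le> chain_length S a b" and n: "enat n \<le> chain_length S b c"
  obtain m' C where C: "m \<le> m'" "C 0 = a" "C m' = b" "\<And>i. i \<le> m' \<Longrightarrow> C i \<in> S"
      "\<And>i. i < m' \<Longrightarrow> C i < C (Suc i)"
    using chain_of_enat_le_chain_length[OF _ _ _ m] assms by metis
  obtain n' D where D: "n \<le> n'" "D 0 = b" "D n' = c" "\<And>i. i \<le> n' \<Longrightarrow> D i \<in> S"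
      "\<And>i. i < n' \<Longrightarrow> D i < D (Suc i)"
    using chain_of_enat_le_chain_length[OF _ _ _ n] assms by metis
  \<comment> \<open>The concatenation: index \<open>m'\<close> is served by \<open>C\<close>, and
    \<open>D 0\<close>, which equals \<open>C m'\<close>, is not repeated, so the numbers of steps
    add.\<close>
  define E where "E i = (if i \<le> m' then C i else D (i - m'))" for i
  have "enat (m' + n') \<le> chain_length S a c"
  proof (rule enat_le_chain_length)
    show "E 0 = a" "E (m' + n') = c"
      using C D by (auto simp: E_def)
    show "E i \<in> S" if "i \<le> m' + n'" for i
      using that C(4)[of i] D(4)[of "i - m'"] by (auto simp: E_def)
    \<comment> \<open>At \<open>i = m'\<close> the definition of \<open>E\<close> changes branch;
      the step there leads from \<open>C m' = D 0\<close> to \<open>D 1\<close>.\<close>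
    show "E i < E (Suc i)" if i: "i < m' + n'" for i
    proof (cases "i < m'")
      case True
      with C(5) show ?thesis by (simp add: E_def)
    next
      case False
      with i D(5)[of "i - m'"] C(3) D(2) show ?thesis
        by (cases "i = m'") (auto simp: E_def Suc_diff_le)
    qed
  qed
  moreover have "enat (m + n) \<le> enat (m' + n')"
    using C(1) D(1) by simp
  ultimately show "enat (m + n) \<le> chain_length S a c"
    by (rule order_trans[rotated])
qed

text \<open>Images of a chain under monotone maps may stall. Dropping the repetitions leaves a chain
  whose steps are exactly the strict ones; the induction appends each of these by
  superadditivity.\<close>

lemma card_strict_steps_le_chain_length:
  fixes C :: "nat \<Rightarrow> 'p::order"
  assumes "\<And>i. i \<le> n \<Longrightarrow> C i \<in> S" "\<And>i. i < n \<Longrightarrow> C i \<le> C (Suc i)"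
  shows "enat (card {i. i < n \<and> C i \<noteq> C (Suc i)}) \<le> chain_length S (C 0) (C n)"
  using assms
proof (induction n)
  case 0
  then show ?case by (simp flip: zero_enat_def)
next
  case (Suc n)
  have IH: "enat (card {i. i < n \<and> C i \<noteq> C (Suc i)}) \<le> chain_length S (C 0) (C n)"
    using Suc by simp
  have le: "C 0 \<le> C n" "C n \<le> C (Suc n)"
    using chain_mono[of "Suc n" C 0 n] Suc.prems(2) by auto
  show ?case
  proof (cases "C n = C (Suc n)")
    case True
    then have "{i. i < Suc n \<and> C i \<noteq> C (Suc i)} = {i. i < n \<and> C i \<noteq> C (Suc i)}"
      by (auto simp: less_Suc_eq)
    with IH True show ?thesis by simp
  next
    case False
    have "enat 1 \<le> chain_length S (C n) (C (Suc n))"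
      by (rule enat_le_chain_length[of "\<lambda>i. if i = 0 then C n else C (Suc n)"])
         (use False le Suc.prems(1) in auto)
    with IH have "enat (card {i. i < n \<and> C i \<noteq> C (Suc i)}) + enat 1 \<le>
        chain_length S (C 0) (C n) + chain_length S (C n) (C (Suc n))"
      by (rule add_mono)
    also have "\<dots> \<le> chain_length S (C 0) (C (Suc n))"
      by (rule chain_length_superadditive) (use Suc.prems(1) le in auto)
    finally have "enat (card {i. i < n \<and> C i \<noteq> C (Suc i)}) + enat 1 \<le>
        chain_length S (C 0) (C (Suc n))" .
    moreover have "{i. i < Suc n \<and> C i \<noteq> C (Suc i)} = insert n {i. i < n \<and> C i \<noteq> C (Suc i)}"
      using False by (auto simp: less_Suc_eq)
    ultimately show ?thesis by simp
  qed
qed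

text \<open>A strictly increasing map carries chains to chains with the same number of steps. It is
  constrained only on the interval, since all members of a chain from \<open>a\<close> to
  \<open>b\<close> lie there.\<close>

lemma chain_length_le_map:
  fixes f :: "'p::order \<Rightarrow> 'q::order"
  assumes "\<And>x. \<lbrakk>x \<in> S; a \<le> x; x \<le> b\<rbrakk> \<Longrightarrow> f x \<in> T"
    and "\<And>x y. \<lbrakk>x \<in> S; y \<in> S; a \<le> x; x < y; y \<le> b\<rbrakk> \<Longrightarrow> f x < f y"
    and "f a = a'" "f b = b'"
  shows "chain_length S a b \<le> chain_length T a' b'"
proof (rule chain_length_least)
  fix n C
  assume C: "C 0 = a" "C n = b" "\<And>i. i \<le> n \<Longrightarrow> C i \<in> S" "\<And>i. i < n \<Longrightarrow> C i < C (Suc i)"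
  have bnd: "a \<le> C i" "C i \<le> b" if "i \<le> n" for i
    using chain_mono[of n C 0 i] chain_mono[of n C i n] C that by (auto simp: less_imp_le)
  show "enat n \<le> chain_length T a' b'"
  proof (rule enat_le_chain_length[of "\<lambda>i. f (C i)"])
    show "f (C 0) = a'" "f (C n) = b'"
      using C assms by simp_all
    show "f (C i) \<in> T" if "i \<le> n" for i
      using assms(1) C(3) bnd that by simp
    show "f (C i) < f (C (Suc i))" if "i < n" for i
      using assms(2) C(3,4) bnd that by simp
  qed
qed

text \<open>The unary maps \<open>meet\<close> and \<open>join\<close> stand for meeting and joining
  with the fixed element \<open>b\<close>; \<open>modular\<close> is the cancellation law of a
  modular lattice. One inequality counts strict steps of the two image chains, the other
  concatenates chains.\<close>

lemma chain_length_interval_additive: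
  fixes meet join :: "'p::order \<Rightarrow> 'p"
  assumes S: "a \<in> S" "b \<in> S" "c \<in> S" and le: "a \<le> b" "b \<le> c"
    and meet: "meet a = a" "meet c = b" "\<And>x. x \<in> S \<Longrightarrow> meet x \<in> S"
      "\<And>x y. x \<le> y \<Longrightarrow> meet x \<le> meet y"
    and join: "join a = b" "join c = c" "\<And>x. x \<in> S \<Longrightarrow> join x \<in> S"
      "\<And>x y. x \<le> y \<Longrightarrow> join x \<le> join y"
    and modular: "\<And>x y. \<lbrakk>x \<in> S; y \<in> S; x \<le> y; meet x = meet y; join x = join y\<rbrakk> \<Longrightarrow> x = y"
  shows "chain_length S a c = chain_length S a b + chain_length S b c"
proof (rule antisym[OF chain_length_least])
  fix n C
  assume C: "C 0 = a" "C n = c" "\<And>i. i \<le> n \<Longrightarrow> C i \<in> S" "\<And>i. i < n \<Longrightarrow> C i < C (Suc i)"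
  define A where "A = {i. i < n \<and> meet (C i) \<noteq> meet (C (Suc i))}"
  define B where "B = {i. i < n \<and> join (C i) \<noteq> join (C (Suc i))}"
  \<comment> \<open>The image of the chain under \<open>meet\<close> runs from
    \<open>meet a = a\<close> to \<open>meet c = b\<close>; under \<open>join\<close> it runs from
    \<open>b\<close> to \<open>c\<close>.\<close>
  have A: "enat (card A) \<le> chain_length S a b"
    using card_strict_steps_le_chain_length[of n "\<lambda>i. meet (C i)" S] C meet
    by (simp add: A_def less_imp_le)
  have B: "enat (card B) \<le> chain_length S b c"
    using card_strict_steps_le_chain_length[of n "\<lambda>i. join (C i)" S] C join
    by (simp add: B_def less_imp_le)
  have "i \<in> A \<union> B" if "i < n" for i
    using modular[of "C i" "C (Suc i)"] C(3)[of i] C(3)[of "Suc i"] C(4)[of i] that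
    by (auto simp: A_def B_def less_imp_le dest: less_imp_neq)
  then have "{..<n} \<subseteq> A \<union> B" by blast
  moreover have "finite (A \<union> B)"
    by (simp add: A_def B_def)
  ultimately have "card {..<n} \<le> card (A \<union> B)"
    by (rule card_mono[rotated])
  \<comment> \<open>A step may stay strict under both maps, so this is only an inequality.\<close>
  also have "\<dots> \<le> card A + card B" by (rule card_Un_le)
  finally have "enat n \<le> enat (card A) + enat (card B)" by simp
  with A B show "enat n \<le> chain_length S a b + chain_length S b c"
    by (meson add_mono order_trans)
qed (use chain_length_superadditive S le in blast)

section \<open>Submodules, their sums and the modular law\<close>

context left_module
begin

text \<open>Closure under additive inverses follows from closure under scalars, because the inverse
  of \<open>x\<close> is minus one times \<open>x\<close>.\<close>

lemma submoduleI_closed: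
  assumes sub: "H \<subseteq> carrier M" and zero: "\<zero>\<^bsub>M\<^esub> \<in> H"
    and add: "\<And>x y. \<lbrakk>x \<in> H; y \<in> H\<rbrakk> \<Longrightarrow> x \<oplus>\<^bsub>M\<^esub> y \<in> H"
    and smult: "\<And>r x. \<lbrakk>r \<in> carrier R; x \<in> H\<rbrakk> \<Longrightarrow> r \<odot>\<^bsub>M\<^esub> x \<in> H"
  shows "submodule H R M"
proof -
  have "\<ominus>\<^bsub>M\<^esub> x = (\<ominus> \<one>) \<odot>\<^bsub>M\<^esub> x" if "x \<in> carrier M" for x
  proof -
    have "(\<ominus> \<one>) \<odot>\<^bsub>M\<^esub> x \<oplus>\<^bsub>M\<^esub> x = (\<ominus> \<one> \<oplus> \<one>) \<odot>\<^bsub>M\<^esub> x"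
      using that by (simp add: smult_l_distr)
    also have "\<dots> = \<zero>\<^bsub>M\<^esub>"
      using that by (simp add: R.l_neg smult_l_null)
    finally show ?thesis
      using that by (simp add: M.minus_equality)
  qed
  then have "\<ominus>\<^bsub>M\<^esub> x \<in> H" if "x \<in> H" for x
    using that sub smult[of "\<ominus> \<one>" x] by auto
  then have "subgroup H (add_monoid M)"
    using sub zero add by (auto simp: subgroup_def a_inv_def)
  then show ?thesis
    using smult by (simp add: submodule_def submodule_axioms_def)
qed

lemma submodule_closed:
  assumes "submodule H R M"
  shows "H \<subseteq> carrier M" "\<zero>\<^bsub>M\<^esub> \<in> H" "\<And>x y. \<lbrakk>x \<in> H; y \<in> H\<rbrakk> \<Longrightarrow> x \<oplus>\<^bsub>M\<^esub> y \<in> H"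
    "\<And>x. x \<in> H \<Longrightarrow> \<ominus>\<^bsub>M\<^esub> x \<in> H" "\<And>r x. \<lbrakk>r \<in> carrier R; x \<in> H\<rbrakk> \<Longrightarrow> r \<odot>\<^bsub>M\<^esub> x \<in> H"
proof -
  have sg: "subgroup H (add_monoid M)"
    using assms by (simp add: submodule_def)
  show "H \<subseteq> carrier M" "\<zero>\<^bsub>M\<^esub> \<in> H" "\<And>x y. \<lbrakk>x \<in> H; y \<in> H\<rbrakk> \<Longrightarrow> x \<oplus>\<^bsub>M\<^esub> y \<in> H"
    using subgroup.subset[OF sg] subgroup.one_closed[OF sg] subgroup.m_closed[OF sg] by simp_all
  show "\<And>x. x \<in> H \<Longrightarrow> \<ominus>\<^bsub>M\<^esub> x \<in> H"
    using subgroup.m_inv_closed[OF sg] by (simp add: a_inv_def)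
  show "\<And>r x. \<lbrakk>r \<in> carrier R; x \<in> H\<rbrakk> \<Longrightarrow> r \<odot>\<^bsub>M\<^esub> x \<in> H"
    using assms by (simp add: submodule_def submodule_axioms_def)
qed

lemma submodule_carrier: "submodule (carrier M) R M"
  by (rule submoduleI_closed) auto

lemma submodule_cyclic_submodule:
  assumes m: "m \<in> carrier M"
  shows "submodule (cyclic_submodule R M m) R M"
proof (rule submoduleI_closed)
  show "\<zero>\<^bsub>M\<^esub> \<in> cyclic_submodule R M m"
    unfolding cyclic_submodule_def using smult_l_null[OF m] by force
  show "x \<oplus>\<^bsub>M\<^esub> y \<in> cyclic_submodule R M m"
    if "x \<in> cyclic_submodule R M m" "y \<in> cyclic_submodule R M m" for x y
    using that m smult_l_distr[symmetric] R.a_closed unfolding cyclic_submodule_def by blast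
  show "r \<odot>\<^bsub>M\<^esub> x \<in> cyclic_submodule R M m"
    if "r \<in> carrier R" "x \<in> cyclic_submodule R M m" for r x
    using that m smult_assoc1[symmetric] R.m_closed unfolding cyclic_submodule_def by blast
qed (use m in \<open>auto simp: cyclic_submodule_def\<close>)

lemma submodule_inter:
  assumes "submodule N R M" "submodule L R M"
  shows "submodule (N \<inter> L) R M"
  by (rule submoduleI_closed) (use submodule_closed[OF assms(1)] submodule_closed[OF assms(2)] in auto)

lemma mem_set_add_iff: "x \<in> N <+>\<^bsub>M\<^esub> L \<longleftrightarrow> (\<exists>n\<in>N. \<exists>l\<in>L. x = n \<oplus>\<^bsub>M\<^esub> l)"
  by (auto simp: set_add_def')

lemma submodule_set_add:
  assumes N: "submodule N R M" and L: "submodule L R M"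
  shows "submodule (N <+>\<^bsub>M\<^esub> L) R M"
proof (rule submoduleI_closed)
  note n = submodule_closed[OF N] and l = submodule_closed[OF L]
  show "N <+>\<^bsub>M\<^esub> L \<subseteq> carrier M"
    using n(1) l(1) M.a_closed by (auto simp: mem_set_add_iff subset_iff)
  show "\<zero>\<^bsub>M\<^esub> \<in> N <+>\<^bsub>M\<^esub> L"
    using n(2) l(2) M.l_zero[OF M.zero_closed] unfolding mem_set_add_iff by metis
  show "x \<oplus>\<^bsub>M\<^esub> y \<in> N <+>\<^bsub>M\<^esub> L" if "x \<in> N <+>\<^bsub>M\<^esub> L" "y \<in> N <+>\<^bsub>M\<^esub> L" for x y
  proof -
    obtain n1 l1 n2 l2 where *: "n1 \<in> N" "l1 \<in> L" "n2 \<in> N" "l2 \<in> L"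
        "x = n1 \<oplus>\<^bsub>M\<^esub> l1" "y = n2 \<oplus>\<^bsub>M\<^esub> l2"
      using \<open>x \<in> _\<close> \<open>y \<in> _\<close> unfolding mem_set_add_iff by blast
    then have "x \<oplus>\<^bsub>M\<^esub> y = (n1 \<oplus>\<^bsub>M\<^esub> n2) \<oplus>\<^bsub>M\<^esub> (l1 \<oplus>\<^bsub>M\<^esub> l2)"
      using n(1) l(1) by (simp add: subset_iff M.a_ac)
    with * n(3) l(3) show ?thesis
      unfolding mem_set_add_iff by blast
  qed
  show "r \<odot>\<^bsub>M\<^esub> x \<in> N <+>\<^bsub>M\<^esub> L" if r: "r \<in> carrier R" and x: "x \<in> N <+>\<^bsub>M\<^esub> L" for r x
  proof -
    obtain n1 l1 where *: "n1 \<in> N" "l1 \<in> L" "x = n1 \<oplus>\<^bsub>M\<^esub> l1"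
      using x unfolding mem_set_add_iff by blast
    then have "r \<odot>\<^bsub>M\<^esub> x = r \<odot>\<^bsub>M\<^esub> n1 \<oplus>\<^bsub>M\<^esub> r \<odot>\<^bsub>M\<^esub> l1"
      using n(1) l(1) r by (simp add: subset_iff smult_r_distr)
    with * n(5) l(5) r show ?thesis
      unfolding mem_set_add_iff by blast
  qed
qed

lemma subset_set_add_left:
  assumes "N \<subseteq> carrier M" "submodule L R M"
  shows "N \<subseteq> N <+>\<^bsub>M\<^esub> L"
proof
  fix x assume "x \<in> N"
  then show "x \<in> N <+>\<^bsub>M\<^esub> L"
    using assms submodule_closed(2)[OF assms(2)] M.r_zero unfolding mem_set_add_iff by (metis subsetD)
qed

lemma set_add_submodule_absorb:
  assumes "submodule L R M" "N \<subseteq> L" "\<zero>\<^bsub>M\<^esub> \<in> N"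
  shows "N <+>\<^bsub>M\<^esub> L = L"
proof (intro equalityI subsetI)
  show "x \<in> L" if "x \<in> N <+>\<^bsub>M\<^esub> L" for x
    using that assms submodule_closed(3)[OF assms(1)] unfolding mem_set_add_iff by blast
  show "x \<in> N <+>\<^bsub>M\<^esub> L" if "x \<in> L" for x
    using that assms submodule_closed(1)[OF assms(1)] M.l_zero unfolding mem_set_add_iff
    by (metis subsetD)
qed

lemma set_add_comm:
  assumes "N \<subseteq> carrier M" "L \<subseteq> carrier M"
  shows "N <+>\<^bsub>M\<^esub> L = L <+>\<^bsub>M\<^esub> N"
proof -
  have "n \<oplus>\<^bsub>M\<^esub> l = l \<oplus>\<^bsub>M\<^esub> n" if "n \<in> N" "l \<in> L" for n l
    using that assms by (intro M.a_comm) auto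
  then show ?thesis
    unfolding set_eq_iff mem_set_add_iff by metis
qed

lemma set_add_mono: "X \<subseteq> Y \<Longrightarrow> X <+>\<^bsub>M\<^esub> B \<subseteq> Y <+>\<^bsub>M\<^esub> B"
  unfolding subset_iff mem_set_add_iff by blast

text \<open>The cancellation form of the modular law. An element \<open>y\<close> of
  \<open>Y\<close> is \<open>x + b\<close> with \<open>x\<close> in \<open>X\<close> and
  \<open>b\<close> in \<open>B\<close>; then \<open>b = -x + y\<close> lies in \<open>Y\<close> and
  in \<open>B\<close>, hence in \<open>X\<close> by the equality of the intersections, and so does
  \<open>y\<close>.\<close>

lemma submodule_modular_eq:
  assumes X: "submodule X R M" and Y: "submodule Y R M" and B: "submodule B R M"
    and le: "X \<subseteq> Y" and meet: "X \<inter> B = Y \<inter> B" and join: "X <+>\<^bsub>M\<^esub> B = Y <+>\<^bsub>M\<^esub> B"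
  shows "X = Y"
proof (rule equalityI[OF le subsetI])
  fix y assume y: "y \<in> Y"
  then have "y \<in> X <+>\<^bsub>M\<^esub> B"
    using subset_set_add_left[OF submodule_closed(1)[OF Y] B] join by blast
  then obtain x b where xb: "x \<in> X" "b \<in> B" "y = x \<oplus>\<^bsub>M\<^esub> b"
    by (auto simp: mem_set_add_iff)
  have car: "x \<in> carrier M" "b \<in> carrier M"
    using xb submodule_closed(1)[OF X] submodule_closed(1)[OF B] by auto
  have "b = \<ominus>\<^bsub>M\<^esub> x \<oplus>\<^bsub>M\<^esub> y"
    using xb car by (simp add: M.r_neg1)
  then have "b \<in> Y"
    using submodule_closed(3,4)[OF Y] xb(1) y le by auto
  with xb(2) meet have "b \<in> X" by blast
  with xb show "y \<in> X"
    using submodule_closed(3)[OF X] by simp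
qed

lemma submodule_modular_strict:
  assumes "submodule X R M" "submodule Y R M" "submodule B R M" "X \<subset> Y"
  shows "X \<inter> B = Y \<inter> B \<Longrightarrow> X <+>\<^bsub>M\<^esub> B \<subset> Y <+>\<^bsub>M\<^esub> B"
    and "X <+>\<^bsub>M\<^esub> B = Y <+>\<^bsub>M\<^esub> B \<Longrightarrow> X \<inter> B \<subset> Y \<inter> B"
  using submodule_modular_eq[OF assms(1-3)] assms(4) set_add_mono[of X Y B] by blast+

section \<open>Interval lengths in the lattice of submodules\<close>

abbreviation submodule_interval_length :: "'b set \<Rightarrow> 'b set \<Rightarrow> enat" where
  "submodule_interval_length \<equiv> chain_length {X. submodule X R M}"

lemma submodule_interval_length_additive:
  assumes A: "submodule A R M" and B: "submodule B R M" and C: "submodule C R M"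
    and le: "A \<subseteq> B" "B \<subseteq> C"
  shows "submodule_interval_length A C = submodule_interval_length A B + submodule_interval_length B C"
proof (rule chain_length_interval_additive[where meet = "\<lambda>X. X \<inter> B" and join = "\<lambda>X. X <+>\<^bsub>M\<^esub> B"])
  show "A <+>\<^bsub>M\<^esub> B = B"
    by (rule set_add_submodule_absorb) (use submodule_closed(2)[OF A] B le in auto)
  \<comment> \<open>Absorption swallows the left summand, so the sum has to be commuted
    first.\<close>
  show "C <+>\<^bsub>M\<^esub> B = C"
    using set_add_submodule_absorb[OF C le(2) submodule_closed(2)[OF B]]
      set_add_comm[OF submodule_closed(1)[OF B] submodule_closed(1)[OF C]] by simp
  show "X = Y" if "X \<in> {X. submodule X R M}" "Y \<in> {X. submodule X R M}" "X \<subseteq> Y"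
    "X \<inter> B = Y \<inter> B" "X <+>\<^bsub>M\<^esub> B = Y <+>\<^bsub>M\<^esub> B" for X Y
    using submodule_modular_eq[of X Y B] that B by simp
qed (use assms in \<open>auto intro: submodule_inter submodule_set_add dest: set_add_mono[THEN subsetD]\<close>)

text \<open>The lattice form of the second isomorphism theorem. Intersecting with \<open>L\<close>
  and adding \<open>N\<close> are strictly increasing maps between the two intervals, one in each
  direction; this gives both inequalities without checking that the maps are mutually
  inverse.\<close>

lemma submodule_interval_length_diamond:
  assumes N: "submodule N R M" and L: "submodule L R M"
  shows "submodule_interval_length N (N <+>\<^bsub>M\<^esub> L) = submodule_interval_length (N \<inter> L) L"
proof (rule antisym)
  have Nc: "N \<subseteq> carrier M" and Lc: "L \<subseteq> carrier M"
    using submodule_closed(1) N L by auto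
  have sum: "(N <+>\<^bsub>M\<^esub> L) <+>\<^bsub>M\<^esub> L = N <+>\<^bsub>M\<^esub> L"
    using set_add_submodule_absorb[OF submodule_set_add[OF N L], of L]
      subset_set_add_left[OF Lc N] submodule_closed(2)[OF L]
      set_add_comm[OF Lc submodule_closed(1)[OF submodule_set_add[OF N L]]]
      set_add_comm[OF Nc Lc] by simp
  show "submodule_interval_length N (N <+>\<^bsub>M\<^esub> L) \<le> submodule_interval_length (N \<inter> L) L"
  proof (rule chain_length_le_map[where f = "\<lambda>X. X \<inter> L"])
    show "(N <+>\<^bsub>M\<^esub> L) \<inter> L = L"
      using subset_set_add_left[OF Lc N] set_add_comm[OF Nc Lc] by blast
    show "X \<inter> L < Y \<inter> L" if "X \<in> {X. submodule X R M}" "Y \<in> {X. submodule X R M}"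
      "N \<le> X" "X < Y" "Y \<le> N <+>\<^bsub>M\<^esub> L" for X Y
    proof (rule submodule_modular_strict(2))
      \<comment> \<open>Every submodule between \<open>N\<close> and \<open>N + L\<close> has the
        same sum with \<open>L\<close>, namely \<open>N + L\<close>, with \<open>sum\<close> as the
        upper bound. By the modular law the growth from \<open>X\<close> to \<open>Y\<close> must
        then show in the intersections.\<close>
      show "X <+>\<^bsub>M\<^esub> L = Y <+>\<^bsub>M\<^esub> L"
        using set_add_mono[of N X L] set_add_mono[of X Y L] set_add_mono[of Y "N <+>\<^bsub>M\<^esub> L" L] that sum
        by auto
    qed (use that L in auto)
  qed (use L in \<open>auto intro: submodule_inter\<close>)
  show "submodule_interval_length (N \<inter> L) L \<le> submodule_interval_length N (N <+>\<^bsub>M\<^esub> L)"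
  proof (rule chain_length_le_map[where f = "\<lambda>X. X <+>\<^bsub>M\<^esub> N"])
    show "(N \<inter> L) <+>\<^bsub>M\<^esub> N = N"
      by (rule set_add_submodule_absorb)
         (use N submodule_closed(2)[OF submodule_inter[OF N L]] in auto)
    show "L <+>\<^bsub>M\<^esub> N = N <+>\<^bsub>M\<^esub> L"
      by (rule set_add_comm[OF Lc Nc])
    \<comment> \<open>Dually, every submodule between \<open>N \<inter> L\<close> and
      \<open>L\<close> meets \<open>N\<close> in \<open>N \<inter> L\<close>, so the growth must
      show in the sums.\<close>
    show "X <+>\<^bsub>M\<^esub> N < Y <+>\<^bsub>M\<^esub> N" if "X \<in> {X. submodule X R M}" "Y \<in> {X. submodule X R M}"
      "N \<inter> L \<le> X" "X < Y" "Y \<le> L" for X Y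
      by (rule submodule_modular_strict(1)) (use that N in auto)
  qed (use N in \<open>auto intro: submodule_set_add\<close>)
qed

section \<open>The length of a quotient module\<close>

text \<open>The correspondence theorem: preimage and image under the projection \<open>?p\<close>
  are strictly increasing maps between the submodules of the quotient and the submodules containing
  \<open>N\<close>, so chains can be moved both ways.\<close>

lemma module_length_quot_module:
  assumes N: "submodule N R M"
  shows "module_length R (quot_module M N) = submodule_interval_length N (carrier M)"
proof -
  let ?Q = "quot_module M N" and ?p = "\<lambda>x. N +>\<^bsub>M\<^esub> x"
  interpret N: abelian_subgroup N M
    by (rule abelian_subgroupI3)
       (use N in \<open>auto simp: additive_subgroup_def submodule_def M.abelian_group_axioms\<close>)
  interpret Q: left_module R ?Q
    by (rule left_module_quot_module[OF N])
  have car: "carrier ?Q = ?p ` carrier M"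
    by (auto simp: quot_module_simps A_RCOSETS_def')
  have zero: "\<zero>\<^bsub>?Q\<^esub> = N"
    by (simp add: quot_module_simps)
  have p_zero: "?p x = N \<longleftrightarrow> x \<in> N" if "x \<in> carrier M" for x
    using that N.a_rcos_self N.a_rcos_const by auto
  have p_add: "?p x \<oplus>\<^bsub>?Q\<^esub> ?p y = ?p (x \<oplus>\<^bsub>M\<^esub> y)" if "x \<in> carrier M" "y \<in> carrier M" for x y
    using that by (simp add: quot_module_simps N.a_rcos_sum)
  have p_smult: "r \<odot>\<^bsub>?Q\<^esub> ?p x = ?p (r \<odot>\<^bsub>M\<^esub> x)" if "r \<in> carrier R" "x \<in> carrier M" for r x
    using that quot_smult[OF N] by simp
  \<comment> \<open>A submodule containing \<open>N\<close> is a union of cosets of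
    \<open>N\<close>, so membership in it can be read off from the coset.\<close>
  have sat: "x \<in> X" if X: "submodule X R M" and "N \<subseteq> X" and x: "x \<in> carrier M" and "?p x \<in> ?p ` X" for x X
  proof -
    obtain y where y: "y \<in> X" "?p x = ?p y"
      using \<open>?p x \<in> ?p ` X\<close> by auto
    have "x \<in> ?p y"
      using N.a_rcos_self[OF x] y by simp
    then obtain n where "n \<in> N" "x = n \<oplus>\<^bsub>M\<^esub> y"
      by (auto simp: a_r_coset_def')
    with y \<open>N \<subseteq> X\<close> submodule_closed(3)[OF X] show ?thesis by blast
  qed
  have image: "submodule (?p ` X) R ?Q" if X: "submodule X R M" for X
  proof (rule Q.submoduleI_closed)
    note c = submodule_closed[OF X]
    show "?p ` X \<subseteq> carrier ?Q"
      using c(1) car by auto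
    show "\<zero>\<^bsub>?Q\<^esub> \<in> ?p ` X"
      using c(2) p_zero[of "\<zero>\<^bsub>M\<^esub>"] submodule_closed(2)[OF N] zero by force
    show "x \<oplus>\<^bsub>?Q\<^esub> y \<in> ?p ` X" if "x \<in> ?p ` X" "y \<in> ?p ` X" for x y
      using that c(1,3) p_add by (force simp: subset_iff)
    show "r \<odot>\<^bsub>?Q\<^esub> x \<in> ?p ` X" if "r \<in> carrier R" "x \<in> ?p ` X" for r x
      using that c(1,5) p_smult by (force simp: subset_iff)
  qed
  have preimage: "submodule {x \<in> carrier M. ?p x \<in> Y} R M" if Y: "submodule Y R ?Q" for Y
  proof (rule submoduleI_closed)
    note c = Q.submodule_closed[OF Y]
    show "\<zero>\<^bsub>M\<^esub> \<in> {x \<in> carrier M. ?p x \<in> Y}"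
      using c(2) p_zero[of "\<zero>\<^bsub>M\<^esub>"] submodule_closed(2)[OF N] zero by simp
    show "x \<oplus>\<^bsub>M\<^esub> y \<in> {x \<in> carrier M. ?p x \<in> Y}"
      if "x \<in> {x \<in> carrier M. ?p x \<in> Y}" "y \<in> {x \<in> carrier M. ?p x \<in> Y}" for x y
      using that c(3)[of "?p x" "?p y"] by (simp add: p_add)
    show "r \<odot>\<^bsub>M\<^esub> x \<in> {x \<in> carrier M. ?p x \<in> Y}"
      if "r \<in> carrier R" "x \<in> {x \<in> carrier M. ?p x \<in> Y}" for r x
      using that c(5)[of r "?p x"] by (simp add: p_smult)
  qed auto
  \<comment> \<open>The zero of the quotient is the coset \<open>N\<close>, so \<open>{N}\<close> is
    its zero submodule, where the chains start.\<close>
  have "module_length R ?Q = chain_length {Y. submodule Y R ?Q} {N} (carrier ?Q)"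
    by (simp add: module_length_def chain_length_def zero)
  also have "\<dots> = submodule_interval_length N (carrier M)"
  proof (rule antisym)
    show "chain_length {Y. submodule Y R ?Q} {N} (carrier ?Q) \<le> submodule_interval_length N (carrier M)"
    proof (rule chain_length_le_map[where f = "\<lambda>Y. {x \<in> carrier M. ?p x \<in> Y}"])
      show "{x \<in> carrier M. ?p x \<in> {N}} = N"
        using p_zero N.a_subset by auto
      show "{x \<in> carrier M. ?p x \<in> carrier ?Q} = carrier M"
        using car by auto
      show "{x \<in> carrier M. ?p x \<in> X} < {x \<in> carrier M. ?p x \<in> Y}"
        if XY: "X < Y" "Y \<le> carrier ?Q" for X Y
      proof -
        obtain y where "y \<in> Y" "y \<notin> X"
          using XY by blast
        \<comment> \<open>Surjectivity of \<open>?p\<close> makes preimages strictly increasing: the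
          new element \<open>y\<close> has a representative, which lies in one preimage and not in
          the other.\<close>
        moreover from this obtain x where "x \<in> carrier M" "y = ?p x"
          using XY(2) car by auto
        ultimately have "x \<in> {x \<in> carrier M. ?p x \<in> Y}" "x \<notin> {x \<in> carrier M. ?p x \<in> X}"
          by simp_all
        moreover have "{x \<in> carrier M. ?p x \<in> X} \<subseteq> {x \<in> carrier M. ?p x \<in> Y}"
          using XY by auto
        ultimately show ?thesis
          by blast
      qed
    qed (use preimage in auto)
    show "submodule_interval_length N (carrier M) \<le> chain_length {Y. submodule Y R ?Q} {N} (carrier ?Q)"
    proof (rule chain_length_le_map[where f = "\<lambda>X. ?p ` X"])
      show "?p ` N = {N}"
      proof -
        have "?p x = N" if "x \<in> N" for x
          using that p_zero N.a_subset by blast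
        then show ?thesis
          using submodule_closed(2)[OF N] unfolding image_def by blast
      qed
      show "?p ` X < ?p ` Y"
        if X: "X \<in> {X. submodule X R M}" and le: "N \<le> X" "X < Y" "Y \<le> carrier M" for X Y
      proof -
        obtain y where y: "y \<in> Y" "y \<notin> X"
          using le(2) by blast
        \<comment> \<open>Saturation makes images strictly increasing: if the coset of
          \<open>y\<close> came from \<open>X\<close>, then \<open>y\<close> itself would lie in
          \<open>X\<close>.\<close>
        then have "?p y \<notin> ?p ` X"
          using sat[of X y] X le by auto
        moreover have "?p y \<in> ?p ` Y"
          using y(1) by (rule imageI)
        moreover have "?p ` X \<subseteq> ?p ` Y"
          using le(2) by (intro image_mono) simp
        ultimately show ?thesis
          by blast
      qed
    qed (use image car in auto)
  qed
  finally show ?thesis .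
qed

section \<open>The length identity for sums and intersections\<close>

text \<open>Both sides become the sum of the lengths of \<open>[N, N + L]\<close>,
  \<open>[N + L, M]\<close> and \<open>[L, M]\<close>. Nothing is cancelled, so the identity also
  makes sense for infinite values in \<open>enat\<close>.\<close>

lemma module_length_quot_add_inter:
  assumes N: "submodule N R M" and L: "submodule L R M"
  shows "module_length R (quot_module M N) + module_length R (quot_module M L) =
    module_length R (quot_module M (N <+>\<^bsub>M\<^esub> L)) + module_length R (quot_module M (N \<inter> L))"
proof -
  note NL = submodule_set_add[OF N L] and I = submodule_inter[OF N L] and c = submodule_carrier
  have "submodule_interval_length N (carrier M) =
      submodule_interval_length N (N <+>\<^bsub>M\<^esub> L) + submodule_interval_length (N <+>\<^bsub>M\<^esub> L) (carrier M)"
    by (rule submodule_interval_length_additive[OF N NL c])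
       (use subset_set_add_left[OF submodule_closed(1)[OF N] L] submodule_closed(1)[OF NL] in auto)
  moreover have "submodule_interval_length (N \<inter> L) (carrier M) =
      submodule_interval_length (N \<inter> L) L + submodule_interval_length L (carrier M)"
    by (rule submodule_interval_length_additive[OF I L c]) (use submodule_closed(1)[OF L] in auto)
  ultimately show ?thesis
    using module_length_quot_module[OF N] module_length_quot_module[OF L]
      module_length_quot_module[OF NL] module_length_quot_module[OF I]
      submodule_interval_length_diamond[OF N L]
    by (simp only: ac_simps)
qed

end

theorem theorem2p15:
  fixes R :: "('a, 'm) ring_scheme" and I :: "'a set"
    and M :: "('a, 'a set) module" and d :: "'a set \<Rightarrow> 'p::order"
  assumes "ring R"
    and "left_ideal I R"
    and "M = quot_module (regular_module R) I"
    and "l_finite_euclidean_module R M d"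
  shows "(\<forall>N L. submodule N R M \<and> N \<noteq> {\<zero>\<^bsub>M\<^esub>} \<and> submodule L R M \<and> L \<noteq> {\<zero>\<^bsub>M\<^esub>} \<longrightarrow>
            module_length R (quot_module M N) + module_length R (quot_module M L) =
            module_length R (quot_module M (N <+>\<^bsub>M\<^esub> L)) + module_length R (quot_module M (N \<inter> L)))
         \<and>
         (\<forall>a\<in>carrier M - {\<zero>\<^bsub>M\<^esub>}. \<forall>b\<in>carrier M - {\<zero>\<^bsub>M\<^esub>}. \<forall>g l.
            is_gcd R M a b g \<and> is_lcm R M a b l \<longrightarrow>
            elem_length R M a + elem_length R M b = elem_length R M g + elem_length R M l)"
proof -
  interpret l_finite_euclidean_module R M d
    by fact
  \<comment> \<open>By definition \<open>g\<close> generates the sum of the cyclic submodules of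
    \<open>a\<close> and \<open>b\<close>, and \<open>l\<close> their intersection, so this is the
    identity for these two submodules.\<close>
  have "elem_length R M a + elem_length R M b = elem_length R M g + elem_length R M l"
    if "a \<in> carrier M" "b \<in> carrier M" "is_gcd R M a b g" "is_lcm R M a b l" for a b g l
    using that module_length_quot_add_inter[OF submodule_cyclic_submodule submodule_cyclic_submodule]
    by (simp add: elem_length_def is_gcd_def is_lcm_def)
  then show ?thesis
    using module_length_quot_add_inter by blast
qed

end
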